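(* The greedy-based algorithm for random-order online weighted bipartite matching with one-sided vertex arrivals, run with parameter $p=\sqrt2-1$, is order-oblivious $(3-2\sqrt2)$-competitive. That is, for every bipartite graph $G=(L,R,E)$ with weights $w:E\to\mathbb{R}_{\ge 0}$, and for any arrival order of the vertices of $L\setminus L'$ after the sampling phase (possibly adversarial and depending on the sample $L'$), the matching output by the algorithm has expected weight at least $(3-2\sqrt2)\cdot \mathrm{OPT}$.
   Context: Setting. An adversary chooses a finite bipartite graph $G=(L,R,E)$ with weights $w:E\to\mathbb{R}_{\ge0}$; ties between weights are broken by a fixed consistent rule, so edge weights are totally ordered. $R$ and $|L|$ are known upfront. The vertices of $L$ arrive online; when $u\in L$ arrives, its incident edges and their weights are revealed and it must be irrevocably matched to a currently unmatched neighbor or left unmatched. $\mathrm{OPT}$ is the maximum weight of a matching in $G$. For $U\subseteq L$, $G[U]$ denotes the subgraph induced on $U\cup R$. $\mathrm{Greedy}(H)$: process the edges of $H$ in non-increasing order of weight, adding an edge to the matching iff neither of its endpoints is already covered. Greedy-based algorithm with parameter $p$: (1) draw $k\sim\mathrm{Binom}(|L|,p)$ and let $L'$ be the first $k$ vertices in a uniformly random arrival order of $L$ (sampling phase; equivalently each vertex of $L$ is in $L'$ independently with probability $p$); set $M=\emptyset$. (2) When a later vertex $u\in L\setminus L'$ arrives, compute $\mathrm{Greedy}(G[L'\cup\{u\}])$; if $u$ is matched in it by an edge $(u,r)$ and $r$ is not yet matched in $M$, add $(u,r)$ to $M$. Output $M$. The algorithm is order-oblivious $c$-competitive if its expected output weight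 is at least $c\cdot\mathrm{OPT}$ on every instance, for any (possibly adversarial) arrival order of $L\setminus L'$ after the sampling phase. *)

theory Defs
  imports "HOL-Probability.Probability"
begin

text \<open>
  A bipartite graph with sides \<open>L\<close> and \<open>R\<close> is given by its edge set \<open>E \<subseteq> L \<times> R\<close>; an edge is a
  pair (online vertex, offline vertex).
\<close>

definition matching :: "('a \<times> 'b) set \<Rightarrow> bool" where
  "matching M \<longleftrightarrow> (\<forall>e\<in>M. \<forall>f\<in>M. e \<noteq> f \<longrightarrow> fst e \<noteq> fst f \<and> snd e \<noteq> snd f)"

definition OPT :: "('a \<times> 'b) set \<Rightarrow> ('a \<times> 'b \<Rightarrow> real) \<Rightarrow> real" where
  "OPT E w = Max {sum w M | M. M \<subseteq> E \<and> matching M}"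

text \<open>Edges of the subgraph induced on \<open>U \<union> R\<close>.\<close>

definition induced :: "('a \<times> 'b) set \<Rightarrow> 'a set \<Rightarrow> ('a \<times> 'b) set" where
  "induced E U = {e \<in> E. fst e \<in> U}"

text \<open>
  A fixed tie-breaking rule amounts to a total order on \<open>E\<close> refining the order by weight. It is
  represented as an enumeration of \<open>E\<close> from first (heaviest) to last, and the same enumeration
  is used for every subgraph on which Greedy is run.
\<close>

definition weight_ordering ::
    "('a \<times> 'b) set \<Rightarrow> ('a \<times> 'b \<Rightarrow> real) \<Rightarrow> ('a \<times> 'b) list \<Rightarrow> bool" where
  "weight_ordering E w es \<longleftrightarrow>
     distinct es \<and> set es = E \<and> sorted_wrt (\<lambda>e f. w e \<ge> w f) es"

definition greedy_step :: "('a \<times> 'b) \<Rightarrow> ('a \<times> 'b) set \<Rightarrow> ('a \<times> 'b) set" where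
  "greedy_step e M = (if fst e \<in> fst ` M \<or> snd e \<in> snd ` M then M else insert e M)"

definition greedy :: "('a \<times> 'b) list \<Rightarrow> ('a \<times> 'b) set \<Rightarrow> ('a \<times> 'b) set" where
  "greedy es H = fold greedy_step (filter (\<lambda>e. e \<in> H) es) {}"

text \<open>
  Distribution of the sample \<open>L'\<close>: the first \<open>k\<close> vertices of a uniformly random ordering of \<open>L\<close>,
  with \<open>k\<close> binomially distributed and drawn independently of the ordering.
\<close>

definition sample_pmf :: "'a set \<Rightarrow> real \<Rightarrow> 'a set pmf" where
  "sample_pmf L p =
     bind_pmf (binomial_pmf (card L) p) (\<lambda>k.
       map_pmf (\<lambda>xs. set (take k xs)) (pmf_of_set (permutations_of_set L)))"

text \<open>
  Arrival of \<open>u\<close> when the current matching is \<open>M\<close>. Since Greedy returns a matching, the set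
  added to \<open>M\<close> has at most one element.
\<close>

definition arrival_step ::
    "('a \<times> 'b) set \<Rightarrow> ('a \<times> 'b) list \<Rightarrow> 'a set \<Rightarrow> 'a \<Rightarrow> ('a \<times> 'b) set \<Rightarrow> ('a \<times> 'b) set" where
  "arrival_step E es L' u M =
     M \<union> {(u, r) | r. (u, r) \<in> greedy es (induced E (L' \<union> {u})) \<and> r \<notin> snd ` M}"

text \<open>The list \<open>us\<close> is the arrival order of the vertices outside the sample \<open>L'\<close>.\<close>

definition greedy_based ::
    "('a \<times> 'b) set \<Rightarrow> ('a \<times> 'b) list \<Rightarrow> 'a set \<Rightarrow> 'a list \<Rightarrow> ('a \<times> 'b) set" where
  "greedy_based E es L' us = fold (arrival_step E es L') us {}"

lemma matching_fold_greedy_step: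
  assumes "matching M"
  shows "matching (fold greedy_step es M) \<and> fold greedy_step es M \<subseteq> M \<union> set es"
  using assms
proof (induction es arbitrary: M)
  case Nil
  then show ?case by simp
next
  case (Cons e es)
  have "matching (greedy_step e M)"
    using Cons.prems unfolding greedy_step_def matching_def
    by (auto simp: image_iff)
  from Cons.IH[OF this] show ?case
    by (auto simp: greedy_step_def split: if_splits)
qed

lemma matching_greedy: "matching (greedy es H)"
  and greedy_subset: "greedy es H \<subseteq> H"
  using matching_fold_greedy_step[of "{}" "filter (\<lambda>e. e \<in> H) es"]
  by (auto simp: greedy_def matching_def)

lemma matching_greedy_based:
  assumes "distinct us"
  shows "matching (greedy_based E es L' us)" and "greedy_based E es L' us \<subseteq> E"
proof -
  have "matching (fold (arrival_step E es L') us M) \<and> fold (arrival_step E es L') us M \<subseteq> E"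
    if "distinct us" "matching M" "M \<subseteq> E" "fst ` M \<inter> set us = {}" for M
    using that
  proof (induction us arbitrary: M)
    case Nil
    then show ?case by simp
  next
    case (Cons u us)
    let ?G = "greedy es (induced E (L' \<union> {u}))"
    have *: "r = s" if "(u, r) \<in> ?G" "(u, s) \<in> ?G" for r s
      using matching_greedy[of es "induced E (L' \<union> {u})"] that unfolding matching_def by fastforce
    have "?G \<subseteq> E"
      using greedy_subset[of es "induced E (L' \<union> {u})"] by (auto simp: induced_def)
    moreover have "matching (arrival_step E es L' u M)"
      unfolding matching_def
    proof (intro ballI impI)
      fix e f
      assume "e \<in> arrival_step E es L' u M" "f \<in> arrival_step E es L' u M" "e \<noteq> f"
      then show "fst e \<noteq> fst f \<and> snd e \<noteq> snd f"
        using Cons.prems(2,4) * unfolding arrival_step_def matching_def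
        by (force simp: image_iff)
    qed
    ultimately have "matching (fold (arrival_step E es L') us (arrival_step E es L' u M)) \<and>
        fold (arrival_step E es L') us (arrival_step E es L' u M) \<subseteq> E"
      using Cons.prems by (intro Cons.IH) (auto simp: arrival_step_def)
    then show ?case by simp
  qed
  from this[of "{}"] show "matching (greedy_based E es L' us)" "greedy_based E es L' us \<subseteq> E"
    using assms by (auto simp: greedy_based_def matching_def)
qed

end

theory Submission
  imports Defs
begin

text \<open>
  Fix a sample \<open>S\<close> and call \<open>e = (u, r)\<close> a candidate if greedy on \<open>S \<union> {u}\<close> picks it. This
  does not depend on whether \<open>u \<in> S\<close>, so if \<open>c e\<close> denotes the probability that \<open>e\<close> is a
  candidate, then \<open>e\<close> lies in the greedy matching of \<open>S\<close> with probability \<open>p * c e\<close>, and it is a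
  tail, that is a candidate with \<open>u \<notin> S\<close>, with probability \<open>(1 - p) * c e\<close>.

  Each edge of an optimal matching is dominated by the candidate of its online vertex or by the
  greedy edge at its offline vertex, whence \<open>OPT \<le> (1 + p) * (\<Sum>e. w e * c e)\<close>. Conversely the
  algorithm matches every offline vertex \<open>r\<close> that has a tail, through some tail, so it gains at
  least the weight of the last (lightest) tail at \<open>r\<close>. Processing edges in greedy order, a tail
  is the last one as soon as the next candidate at \<open>r\<close> has its online vertex in \<open>S\<close>, so it is
  the last one with conditional probability at least \<open>p\<close>. This gives the ratio
  \<open>p * (1 - p) / (1 + p)\<close>, which is maximal at \<open>p = sqrt 2 - 1\<close>.
\<close>

section \<open>The sampling distribution\<close>

text \<open>The mass of \<open>S\<close> when each vertex of \<open>L\<close> is kept independently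
  with probability \<open>p\<close>.\<close>

definition binomial_weight :: "'a set \<Rightarrow> real \<Rightarrow> 'a set \<Rightarrow> real" where
  "binomial_weight L p S = p ^ card S * (1 - p) ^ card (L - S)"

text \<open>Such a permutation splits uniquely into an ordering of \<open>S\<close> followed by an
  ordering of \<open>L - S\<close>.\<close>

lemma card_permutations_of_set_prefix:
  assumes "finite L" "S \<subseteq> L"
  shows "card {xs \<in> permutations_of_set L. set (take (card S) xs) = S}
    = fact (card S) * fact (card L - card S)"
proof -
  have fin: "finite S" "finite (L - S)"
    using assms finite_subset by auto
  have "{xs \<in> permutations_of_set L. set (take (card S) xs) = S}
      = (\<lambda>(a, b). a @ b) ` (permutations_of_set S \<times> permutations_of_set (L - S))" (is "?A = ?B")
  proof
    show "?A \<subseteq> ?B"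
    proof
      fix xs assume xs: "xs \<in> ?A"
      let ?a = "take (card S) xs" and ?b = "drop (card S) xs"
      have d: "distinct xs" "set xs = L" "set ?a = S"
        using xs by (auto simp: permutations_of_set_def)
      have "distinct (?a @ ?b)" "set (?a @ ?b) = L"
        using d by simp_all
      then have "set ?b = L - S" "distinct ?b" "distinct ?a"
        unfolding distinct_append set_append using d(3) by auto
      then have "?a \<in> permutations_of_set S" "?b \<in> permutations_of_set (L - S)"
        using d(3) by (auto simp: permutations_of_set_def)
      then show "xs \<in> ?B"
        by (intro image_eqI[where x = "(?a, ?b)"]) auto
    qed
    show "?B \<subseteq> ?A"
      using assms(2) by (auto simp: permutations_of_set_def distinct_card)
  qed
  moreover have "inj_on (\<lambda>(a, b). a @ b) (permutations_of_set S \<times> permutations_of_set (L - S))"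
    by (auto simp: inj_on_def length_finite_permutations_of_set)
  ultimately show ?thesis
    using fin assms by (simp add: card_image card_cartesian_product card_Diff_subset)
qed

text \<open>Only \<open>k = card S\<close> contributes, and the share of permutations with prefix
  set \<open>S\<close> cancels the binomial coefficient. Hence the two-stage draw is independent
  sampling.\<close>

lemma pmf_sample_pmf:
  assumes "finite L" "S \<subseteq> L" "0 \<le> p" "p \<le> 1"
  shows "pmf (sample_pmf L p) S = binomial_weight L p S"
proof -
  let ?n = "card L" and ?k = "card S"
  let ?P = "\<lambda>k. {xs \<in> permutations_of_set L. set (take k xs) = S}"
  have kn: "?k \<le> ?n"
    using assms card_mono by blast
  have finP: "finite (permutations_of_set L)" "permutations_of_set L \<noteq> {}"
    using assms by auto
  have *: "pmf (map_pmf (\<lambda>xs. set (take k xs)) (pmf_of_set (permutations_of_set L))) S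
      = card (?P k) / fact ?n" for k
  proof -
    have "(\<lambda>xs. set (take k xs)) -` {S} \<inter> permutations_of_set L = ?P k"
      by auto
    then show ?thesis
      using finP assms(1) by (simp add: pmf_map measure_pmf_of_set Int_commute)
  qed
  \<comment> \<open>The bound on \<open>k\<close> matters: \<open>take k\<close> saturates, so for
    \<open>S = L\<close> every \<open>k\<close> above \<open>?n\<close> yields \<open>S\<close>
    too.\<close>
  have empty: "?P k = {}" if "k \<le> ?n" "k \<noteq> ?k" for k
  proof -
    have "card (set (take k xs)) = k" if "xs \<in> permutations_of_set L" for xs
    proof -
      have "distinct (take k xs)" "length xs = ?n"
        using that by (auto simp: permutations_of_set_def distinct_card)
      then show ?thesis
        using \<open>k \<le> ?n\<close> by (simp add: distinct_card)
    qed
    then show ?thesis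
      using that(2) by auto
  qed
  have "pmf (sample_pmf L p) S
      = measure_pmf.expectation (binomial_pmf ?n p) (\<lambda>k. card (?P k) / fact ?n)"
    unfolding sample_pmf_def pmf_bind * ..
  also have "\<dots> = (\<Sum>k\<le>?n. card (?P k) / fact ?n * pmf (binomial_pmf ?n p) k)"
    using set_pmf_binomial_eq[of p ?n] assms
    by (intro integral_measure_pmf_real) (auto split: if_splits)
  also have "\<dots> = (\<Sum>k\<in>{?k}. card (?P k) / fact ?n * pmf (binomial_pmf ?n p) k)"
    using kn empty by (intro sum.mono_neutral_right) auto
  also have "\<dots> = fact ?k * fact (?n - ?k) / fact ?n
      * ((?n choose ?k) * p ^ ?k * (1 - p) ^ (?n - ?k))"
    using card_permutations_of_set_prefix[OF assms(1,2)] assms kn by simp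
  also have "\<dots> = binomial_weight L p S"
    using binomial_fact[OF kn, where 'a = real] assms finite_subset[OF assms(2,1)]
    by (simp add: binomial_weight_def card_Diff_subset)
  finally show ?thesis .
qed

lemma expectation_sample_pmf:
  fixes f :: "'a set \<Rightarrow> real"
  assumes "finite L" "0 \<le> p" "p \<le> 1"
  shows "measure_pmf.expectation (sample_pmf L p) f = (\<Sum>S\<in>Pow L. f S * binomial_weight L p S)"
proof -
  have "measure_pmf.expectation (sample_pmf L p) f = (\<Sum>S\<in>Pow L. f S * pmf (sample_pmf L p) S)"
  proof (rule integral_measure_pmf_real)
    show "S \<in> Pow L" if "S \<in> set_pmf (sample_pmf L p)" for S
      using that assms(1)
      by (auto simp: sample_pmf_def permutations_of_setD dest!: in_set_takeD)
  qed (use assms in auto)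
  then show ?thesis
    using assms by (simp add: pmf_sample_pmf)
qed

lemma sum_binomial_weight:
  assumes "finite L" "0 \<le> p" "p \<le> 1"
  shows "(\<Sum>S\<in>Pow L. binomial_weight L p S) = 1"
  using expectation_sample_pmf[OF assms, of "\<lambda>_. 1"] by simp

lemma binomial_weight_nonneg: "0 \<le> p \<Longrightarrow> p \<le> 1 \<Longrightarrow> 0 \<le> binomial_weight L p S"
  by (simp add: binomial_weight_def)

text \<open>One factor \<open>1 - p\<close> becomes \<open>p\<close>. The cross-multiplied form
  avoids division and needs no bounds on \<open>p\<close>.\<close>

lemma binomial_weight_insert:
  assumes "finite L" "S \<subseteq> L" "u \<in> L" "u \<notin> S"
  shows "(1 - p) * binomial_weight L p (insert u S) = p * binomial_weight L p S"
proof -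
  have "L - S = insert u (L - insert u S)"
    using assms by auto
  then have "card (L - S) = Suc (card (L - insert u S))"
    using assms by (metis Diff_iff card_insert_disjoint finite_Diff insertI1)
  moreover have "card (insert u S) = Suc (card S)"
    using assms finite_subset[of S L] by simp
  ultimately show ?thesis
    by (simp add: binomial_weight_def)
qed

text \<open>An event insensitive to inserting \<open>u\<close> is independent of \<open>u\<close>
  being sampled: \<open>insert u\<close> pairs the sets without \<open>u\<close> with those
  containing it.\<close>

lemma sum_binomial_weight_indep:
  assumes "finite L" "u \<in> L" and Q: "\<And>S. Q (insert u S) \<longleftrightarrow> Q S"
  shows sum_binomial_weight_notin: "sum (binomial_weight L p) {S \<in> Pow L. u \<notin> S \<and> Q S}
      = (1 - p) * sum (binomial_weight L p) {S \<in> Pow L. Q S}" (is "?N = _ * ?T")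
    and sum_binomial_weight_in: "sum (binomial_weight L p) {S \<in> Pow L. u \<in> S \<and> Q S}
      = p * sum (binomial_weight L p) {S \<in> Pow L. Q S}" (is "?I = _")
proof -
  let ?b = "binomial_weight L p"
  have bij: "bij_betw (insert u) {S \<in> Pow L. u \<notin> S \<and> Q S} {S \<in> Pow L. u \<in> S \<and> Q S}"
  proof (rule bij_betwI[where g = "\<lambda>S. S - {u}"])
    show "(\<lambda>S. S - {u}) \<in> {S \<in> Pow L. u \<in> S \<and> Q S} \<rightarrow> {S \<in> Pow L. u \<notin> S \<and> Q S}"
      using Q by (auto simp: insert_absorb) (metis Q insert_Diff)
  qed (use assms(2) Q in auto)
  have "(1 - p) * ?I = (\<Sum>S\<in>{S \<in> Pow L. u \<notin> S \<and> Q S}. (1 - p) * ?b (insert u S))"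
    unfolding sum_distrib_left by (rule sum.reindex_bij_betw[OF bij, symmetric])
  also have "\<dots> = p * ?N"
    unfolding sum_distrib_left
    using binomial_weight_insert[OF assms(1) _ assms(2)] by (intro sum.cong) auto
  finally have 1: "(1 - p) * ?I = p * ?N" .
  have "{S \<in> Pow L. Q S} = {S \<in> Pow L. u \<in> S \<and> Q S} \<union> {S \<in> Pow L. u \<notin> S \<and> Q S}"
    by auto
  then have 2: "?T = ?I + ?N"
    using assms(1) by (simp only:) (subst sum.union_disjoint; auto)
  show "?I = p * ?T" "?N = (1 - p) * ?T"
    using 1 2 by (auto simp: algebra_simps)
qed


section \<open>Greedy\<close>

text \<open>Positions turn the greedy order into a comparison of naturals, so that strong induction
  and \<open>arg_min\<close> apply.\<close>

definition rank :: "'e list \<Rightarrow> 'e \<Rightarrow> nat" where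
  "rank es e = length (takeWhile (\<lambda>f. f \<noteq> e) es)"

lemma rank_less_length: "e \<in> set es \<Longrightarrow> rank es e < length es"
  and nth_rank: "e \<in> set es \<Longrightarrow> es ! rank es e = e"
proof -
  assume "e \<in> set es"
  then show l: "rank es e < length es"
    by (induction es) (auto simp: rank_def)
  then show "es ! rank es e = e"
    unfolding rank_def using nth_length_takeWhile by blast
qed

lemma inj_on_rank: "inj_on (rank es) (set es)"
  by (metis inj_onI nth_rank)

lemma rank_append: "e \<in> set xs \<Longrightarrow> rank (xs @ ys) e = rank xs e"
  by (simp add: rank_def)

lemma rank_snoc: "x \<notin> set xs \<Longrightarrow> rank (xs @ [x]) x = length xs"
  unfolding rank_def by (subst takeWhile_append2) auto

lemma sorted_wrt_rank:
  assumes "sorted_wrt P es" "e \<in> set es" "f \<in> set es" "rank es e < rank es f"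
  shows "P e f"
  using assms by (metis nth_rank rank_less_length sorted_wrt_nth_less)

lemma greedy_snoc:
  "greedy (xs @ [x]) H = (if x \<in> H then greedy_step x (greedy xs H) else greedy xs H)"
  by (simp add: greedy_def)

lemma greedy_subset_set: "greedy es H \<subseteq> set es"
  using matching_fold_greedy_step[of "{}" "filter (\<lambda>e. e \<in> H) es"]
  by (auto simp: greedy_def matching_def)

text \<open>This replaces the fold by a recursion along \<open>rank\<close>. Induction from the
  right works because the last edge cannot affect earlier decisions.\<close>

lemma in_greedy_iff:
  assumes "distinct es"
  shows "e \<in> greedy es H \<longleftrightarrow> e \<in> set es \<and> e \<in> H \<and>
    (\<forall>f\<in>greedy es H. rank es f < rank es e \<longrightarrow> fst f \<noteq> fst e \<and> snd f \<noteq> snd e)"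
  using assms
proof (induction es rule: rev_induct)
  case Nil
  then show ?case by (simp add: greedy_def)
next
  case (snoc x xs)
  let ?G = "greedy xs H" and ?G' = "greedy (xs @ [x]) H"
  have x: "x \<notin> set xs" and IH: "e \<in> ?G \<longleftrightarrow> e \<in> set xs \<and> e \<in> H \<and>
      (\<forall>f\<in>?G. rank xs f < rank xs e \<longrightarrow> fst f \<noteq> fst e \<and> snd f \<noteq> snd e)"
    using snoc by auto
  have sub: "?G \<subseteq> set xs"
    by (rule greedy_subset_set)
  have G': "f \<in> ?G' \<longleftrightarrow> f \<in> ?G \<or> f = x \<and> x \<in> H \<and> (\<forall>g\<in>?G. fst g \<noteq> fst x \<and> snd g \<noteq> snd x)" for f
    unfolding greedy_snoc greedy_step_def by (auto simp: image_iff)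
  consider "e \<in> set xs" | "e = x" | "e \<notin> set (xs @ [x])"
    by auto
  then show ?case
  proof cases
    case 1
    then have "rank (xs @ [x]) e = rank xs e" "rank xs e < rank (xs @ [x]) x"
      using x by (simp_all add: rank_append rank_snoc rank_less_length)
    moreover have "rank (xs @ [x]) f = rank xs f" if "f \<in> ?G" for f
      using that sub by (auto simp: rank_append)
    ultimately have "(\<forall>f\<in>?G'. rank (xs @ [x]) f < rank (xs @ [x]) e \<longrightarrow> fst f \<noteq> fst e \<and> snd f \<noteq> snd e)
        \<longleftrightarrow> (\<forall>f\<in>?G. rank xs f < rank xs e \<longrightarrow> fst f \<noteq> fst e \<and> snd f \<noteq> snd e)"
      using G' by (metis less_asym)
    moreover have "e \<in> ?G' \<longleftrightarrow> e \<in> ?G"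
      using 1 x G' by blast
    ultimately show ?thesis
      using 1 IH by simp
  next
    case 2
    have "rank (xs @ [x]) f < rank (xs @ [x]) x" if "f \<in> ?G" for f
      using that sub x by (auto simp: rank_append rank_snoc rank_less_length)
    then have "(\<forall>f\<in>?G'. rank (xs @ [x]) f < rank (xs @ [x]) e \<longrightarrow> fst f \<noteq> fst e \<and> snd f \<noteq> snd e)
        \<longleftrightarrow> (\<forall>f\<in>?G. fst f \<noteq> fst e \<and> snd f \<noteq> snd e)"
      using 2 G' by (metis less_irrefl)
    moreover have "e \<in> ?G' \<longleftrightarrow> x \<in> H \<and> (\<forall>f\<in>?G. fst f \<noteq> fst e \<and> snd f \<noteq> snd e)"
      using 2 G' x sub by blast
    ultimately show ?thesis
      using 2 by simp
  next
    case 3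
    then show ?thesis
      using greedy_subset_set by blast
  qed
qed

text \<open>Injectivity of \<open>g\<close> makes the fibres disjoint, so each element of
  \<open>X\<close> is charged at most once.\<close>

lemma sum_fibres_le:
  fixes w :: "'e \<Rightarrow> real"
  assumes "finite M" "finite X" "inj_on g M" "\<And>f. f \<in> X \<Longrightarrow> 0 \<le> w f"
  shows "(\<Sum>e\<in>M. \<Sum>f\<in>{f \<in> X. h f = g e}. w f) \<le> sum w X"
proof -
  have "(\<Sum>e\<in>M. \<Sum>f\<in>{f \<in> X. h f = g e}. w f) = sum w (\<Union>e\<in>M. {f \<in> X. h f = g e})"
    by (rule sum.UNION_disjoint[symmetric]) (use assms(1,2) inj_onD[OF assms(3)] in auto)
  also have "\<dots> \<le> sum w X"
    by (rule sum_mono2) (use assms in auto)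
  finally show ?thesis .
qed

section \<open>Candidates and free edges for a fixed sample\<close>

locale greedy_matching =
  fixes L :: "'a set" and E :: "('a \<times> 'b) set" and w :: "'a \<times> 'b \<Rightarrow> real"
    and es :: "('a \<times> 'b) list"
  assumes finite_L: "finite L"
    and fst_in_L: "e \<in> E \<Longrightarrow> fst e \<in> L"
    and w_nonneg: "e \<in> E \<Longrightarrow> 0 \<le> w e"
    and weight_ordering: "weight_ordering E w es"
begin

abbreviation before :: "'a \<times> 'b \<Rightarrow> 'a \<times> 'b \<Rightarrow> bool" (infix "\<lhd>" 50) where
  "e \<lhd> f \<equiv> rank es e < rank es f"

definition G :: "'a set \<Rightarrow> ('a \<times> 'b) set" where
  "G S = greedy es (induced E S)"

text \<open>For \<open>u \<notin> S\<close>, the edge \<open>(u, r)\<close> is a candidate iff it is the edge that the algorithm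
  with sample \<open>S\<close> tries to add when \<open>u\<close> arrives; for \<open>u \<in> S\<close>, iff it belongs to
  \<open>G S\<close>. Whether it is a candidate does not depend on whether \<open>u \<in> S\<close>.\<close>

definition cand :: "'a \<times> 'b \<Rightarrow> 'a set \<Rightarrow> bool" where
  "cand e S \<longleftrightarrow> e \<in> G (insert (fst e) S)"

text \<open>Only the offline endpoint is tested, which makes sense whether or not the online
  endpoint is in \<open>S\<close>.\<close>

definition free :: "'a \<times> 'b \<Rightarrow> 'a set \<Rightarrow> bool" where
  "free e S \<longleftrightarrow> (\<forall>g\<in>G S. g \<lhd> e \<longrightarrow> snd g \<noteq> snd e)"

lemma set_es: "set es = E" and distinct_es: "distinct es"
  and sorted_es: "sorted_wrt (\<lambda>e f. w e \<ge> w f) es"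
  using weight_ordering by (auto simp: weight_ordering_def)

lemma finite_E: "finite E"
  using set_es by auto

lemma rank_eqD: "e \<in> E \<Longrightarrow> f \<in> E \<Longrightarrow> rank es e = rank es f \<Longrightarrow> e = f"
  using inj_on_rank[of es] set_es by (auto simp: inj_on_def)

lemma w_antimono: "e \<in> E \<Longrightarrow> f \<in> E \<Longrightarrow> rank es e \<le> rank es f \<Longrightarrow> w f \<le> w e"
  using sorted_wrt_rank[OF sorted_es, of e f] set_es rank_eqD[of e f] by fastforce

lemma in_G_iff:
  "e \<in> G S \<longleftrightarrow> e \<in> E \<and> fst e \<in> S \<and> (\<forall>f\<in>G S. f \<lhd> e \<longrightarrow> fst f \<noteq> fst e \<and> snd f \<noteq> snd e)"
  unfolding G_def by (subst in_greedy_iff[OF distinct_es]) (auto simp: set_es induced_def)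

lemma G_subset: "G S \<subseteq> E"
  using in_G_iff by blast

lemma G_eqI: "e \<in> G S \<Longrightarrow> f \<in> G S \<Longrightarrow> fst e = fst f \<or> snd e = snd f \<Longrightarrow> e = f"
  using matching_greedy[of es "induced E S"] unfolding G_def matching_def by blast

lemma cand_insert: "cand e (insert (fst e) S) \<longleftrightarrow> cand e S"
  by (simp add: cand_def)

lemma cand_in: "fst e \<in> S \<Longrightarrow> cand e S \<longleftrightarrow> e \<in> G S"
  by (simp add: cand_def insert_absorb)

text \<open>The first disagreement of the two greedy runs can only be an edge at \<open>u\<close>
  picked by the larger run. Both runs agree before it, so it would be free for \<open>S\<close>,
  which the second assumption excludes.\<close>

lemma G_insert_before:
  assumes "u \<notin> S" and *: "\<And>f. f \<in> E \<Longrightarrow> f \<lhd> e \<Longrightarrow> fst f = u \<Longrightarrow>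
      f \<in> G (insert u S) \<Longrightarrow> free f S \<Longrightarrow> False" and "f \<lhd> e"
  shows "f \<in> G (insert u S) \<longleftrightarrow> f \<in> G S"
  using \<open>f \<lhd> e\<close>
proof (induction "rank es f" arbitrary: f rule: less_induct)
  case less
  have IH: "g \<in> G (insert u S) \<longleftrightarrow> g \<in> G S" if "g \<lhd> f" for g
    using less that by simp
  show ?case
  proof (cases "fst f = u")
    case False
    then show ?thesis
      by (subst (1 2) in_G_iff) (use IH in auto)
  next
    case True
    moreover have "f \<notin> G S"
      using True assms(1) in_G_iff by blast
    moreover have "free f S" if "f \<in> G (insert u S)"
      using that IH in_G_iff[of f "insert u S"] unfolding free_def by blast
    ultimately show ?thesis
      using * less(2) in_G_iff by blast
  qed
qed

text \<open>An online vertex gets its first edge whose offline end is still open. The right-hand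
  side refers to \<open>G S\<close> only, so candidates of different vertices can be compared within
  one greedy run.\<close>

lemma cand_iff_first_free:
  "cand e S \<longleftrightarrow> e \<in> E \<and> free e S \<and> (\<forall>f\<in>E. f \<lhd> e \<and> fst f = fst e \<longrightarrow> \<not> free f S)"
  (is "_ \<longleftrightarrow> ?R")
proof (cases "fst e \<in> S")
  case True
  have "e \<in> G S \<longleftrightarrow> ?R"
  proof
    assume e: "e \<in> G S"
    have "\<not> free f S" if "f \<in> E" "f \<lhd> e" "fst f = fst e" for f
    proof -
      have "f \<notin> G S" "fst f \<in> S"
        using e G_eqI[of e S f] that True by auto
      then obtain g where g: "g \<in> G S" "g \<lhd> f" "fst g = fst f \<or> snd g = snd f"
        using \<open>f \<in> E\<close> in_G_iff[of f S] by blast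
      \<comment> \<open>A blocking edge at \<open>fst e\<close> would precede \<open>e\<close> and
        exclude it, so the conflict is at the offline vertex.\<close>
      moreover have "fst g \<noteq> fst f"
        using e g that in_G_iff[of e S] by auto
      ultimately show ?thesis
        by (auto simp: free_def)
    qed
    then show ?R
      using e in_G_iff[of e S] by (auto simp: free_def)
  next
    assume R: ?R
    have "free f S" if "f \<in> G S" for f
      using that in_G_iff[of f S] by (auto simp: free_def)
    then show "e \<in> G S"
      using R True G_subset in_G_iff[of e S] unfolding free_def by (metis subsetD)
  qed
  then show ?thesis
    using True by (simp add: cand_in)
next
  case False
  let ?T = "insert (fst e) S"
  show ?thesis
  proof
    assume "cand e S"
    then have e: "e \<in> G ?T"
      by (simp add: cand_def)
    \<comment> \<open>Here the matching property excludes an earlier edge at \<open>fst e\<close>;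
      in the converse direction it is the absence of earlier free edges.\<close>
    have agree: "f \<in> G ?T \<longleftrightarrow> f \<in> G S" if "f \<lhd> e" for f
      using False _ that
    proof (rule G_insert_before)
      fix f assume "f \<lhd> e" "fst f = fst e" "f \<in> G ?T"
      then show False
        using e G_eqI[of e ?T f] by auto
    qed
    have "\<not> free f S" if f: "f \<in> E" "f \<lhd> e" "fst f = fst e" for f
    proof -
      have "f \<notin> G ?T"
        using e G_eqI[of e ?T f] that by auto
      then obtain g where g: "g \<in> G ?T" "g \<lhd> f" "fst g = fst f \<or> snd g = snd f"
        using f in_G_iff[of f ?T] by (metis insertI1)
      moreover have "fst g \<noteq> fst f"
        using e g f in_G_iff[of e ?T] by auto
      ultimately show ?thesis
        using agree[of g] f(2) by (auto simp: free_def)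
    qed
    then show ?R
      using e agree in_G_iff[of e ?T] by (auto simp: free_def)
  next
    assume R: ?R
    have agree: "f \<in> G ?T \<longleftrightarrow> f \<in> G S" if "f \<lhd> e" for f
      using False _ that by (rule G_insert_before) (use R in auto)
    have "e \<in> G ?T"
    proof (subst in_G_iff, intro conjI ballI impI)
      fix f assume f: "f \<in> G ?T" "f \<lhd> e"
      then have "f \<in> G S"
        using agree by blast
      then show "snd f \<noteq> snd e" "fst f \<noteq> fst e"
        using R f(2) False in_G_iff[of f S] by (auto simp: free_def)
    qed (use R in auto)
    then show "cand e S"
      by (simp add: cand_def)
  qed
qed

lemma cand_in_E: "cand e S \<Longrightarrow> e \<in> E"
  and cand_free: "cand e S \<Longrightarrow> free e S"
  using cand_iff_first_free by auto

lemma cand_unique: "cand e S \<Longrightarrow> cand f S \<Longrightarrow> fst e = fst f \<Longrightarrow> e = f"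
  using G_eqI[of e "insert (fst e) S" f] by (simp add: cand_def)

lemma free_imp_cand:
  assumes "e \<in> E" "free e S"
  obtains f where "cand f S" "fst f = fst e" "rank es f \<le> rank es e"
proof -
  define f where "f = arg_min (rank es) (\<lambda>f. f \<in> E \<and> fst f = fst e \<and> free f S)"
  have f: "f \<in> E \<and> fst f = fst e \<and> free f S"
    unfolding f_def by (rule arg_min_natI[where k = e]) (use assms in auto)
  have min: "rank es f \<le> rank es g" if "g \<in> E" "fst g = fst e" "free g S" for g
    unfolding f_def by (rule arg_min_nat_le) (use that in auto)
  show ?thesis
  proof (rule that)
    show "cand f S"
      using f min by (force simp: cand_iff_first_free)
  qed (use f min assms in auto)
qed

lemma finite_cand: "finite {f. cand f S \<and> Q f}"
  using finite_E by (rule rev_finite_subset) (auto intro: cand_in_E)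

lemma finite_G: "finite (G S)"
  using G_subset finite_E finite_subset by blast

text \<open>A free edge is charged to the candidate at its online end, any other edge to the greedy
  edge blocking its offline end. In a matching both endpoint maps are injective, so nothing is
  charged twice on either side.\<close>

lemma matching_weight_le:
  assumes "M \<subseteq> E" "matching M"
  shows "sum w M \<le> sum w {f. cand f S} + sum w (G S)"
proof -
  let ?C = "{f. cand f S}"
  have finC: "finite ?C"
    using finite_cand[of S "\<lambda>_. True"] by simp
  have finM: "finite M"
    using assms(1) finite_E finite_subset by blast
  have nonneg: "0 \<le> sum w {f \<in> ?C. P f}" "0 \<le> sum w {f \<in> G S. P f}" for P
    by (auto intro!: sum_nonneg w_nonneg intro: cand_in_E subsetD[OF G_subset])
  have "w e \<le> sum w {f \<in> ?C. fst f = fst e} + sum w {f \<in> G S. snd f = snd e}" if e: "e \<in> M" for e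
  proof (cases "free e S")
    case True
    then obtain f where f: "cand f S" "fst f = fst e" "rank es f \<le> rank es e"
      using free_imp_cand[of e S] e assms(1) by auto
    then have "w e \<le> w f"
      using w_antimono cand_in_E e assms(1) by blast
    also have "w f \<le> sum w {f \<in> ?C. fst f = fst e}"
      using f finC w_nonneg cand_in_E by (intro member_le_sum) auto
    finally show ?thesis
      using nonneg(2)[of "\<lambda>f. snd f = snd e"] by simp
  next
    case False
    then obtain g where g: "g \<in> G S" "g \<lhd> e" "snd g = snd e"
      by (auto simp: free_def)
    then have "w e \<le> w g"
      using w_antimono[of g e] G_subset e assms(1) by auto
    also have "w g \<le> sum w {f \<in> G S. snd f = snd e}"
      using g finite_G w_nonneg subsetD[OF G_subset] by (intro member_le_sum) auto
    finally show ?thesis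
      using nonneg(1)[of "\<lambda>f. fst f = fst e"] by simp
  qed
  then have "sum w M
      \<le> (\<Sum>e\<in>M. sum w {f \<in> ?C. fst f = fst e} + sum w {f \<in> G S. snd f = snd e})"
    by (rule sum_mono)
  also have "\<dots> = (\<Sum>e\<in>M. sum w {f \<in> ?C. fst f = fst e}) + (\<Sum>e\<in>M. sum w {f \<in> G S. snd f = snd e})"
    by (rule sum.distrib)
  also have "\<dots> \<le> sum w ?C + sum w (G S)"
  proof (intro add_mono sum_fibres_le)
    show "inj_on fst M" "inj_on snd M"
      using assms(2) by (auto simp: inj_on_def matching_def)
  qed (use finM finC finite_G w_nonneg cand_in_E subsetD[OF G_subset] in auto)
  finally show ?thesis .
qed


section \<open>The output of the algorithm\<close>

definition tail :: "'a \<times> 'b \<Rightarrow> 'a set \<Rightarrow> bool" where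
  "tail e S \<longleftrightarrow> fst e \<notin> S \<and> cand e S"

text \<open>Maximal rank means least weight, so this tail bounds from below whichever tail at the
  same offline vertex the arrival order favours.\<close>

definition last_tail :: "'a \<times> 'b \<Rightarrow> 'a set \<Rightarrow> bool" where
  "last_tail e S \<longleftrightarrow> tail e S \<and> (\<forall>f. tail f S \<and> snd f = snd e \<longrightarrow> rank es f \<le> rank es e)"

lemma last_tail_max: "last_tail e S \<Longrightarrow> tail f S \<Longrightarrow> snd f = snd e \<Longrightarrow> rank es f \<le> rank es e"
  unfolding last_tail_def by blast

lemma arrival_step_eq:
  "arrival_step E es S u M = M \<union> {e. fst e = u \<and> cand e S \<and> snd e \<notin> snd ` M}"
  unfolding arrival_step_def cand_def G_def by force

lemma greedy_based_cand:
  assumes "e \<in> greedy_based E es S us"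
  shows "cand e S \<and> fst e \<in> set us"
proof -
  have "e \<in> fold (arrival_step E es S) us M \<Longrightarrow> e \<in> M \<or> cand e S \<and> fst e \<in> set us" for M
    by (induction us arbitrary: M) (fastforce simp: arrival_step_eq)+
  then show ?thesis
    using assms by (auto simp: greedy_based_def)
qed

text \<open>When \<open>fst e\<close> arrives, \<open>snd e\<close> is already taken or
  \<open>e\<close> is added, and edges are never removed.\<close>

lemma greedy_based_covers:
  assumes "cand e S" "fst e \<in> set us"
  shows "snd e \<in> snd ` greedy_based E es S us"
proof -
  have mono: "M \<subseteq> fold (arrival_step E es S) us M" for M us
    by (induction us arbitrary: M) (fastforce simp: arrival_step_eq)+
  have "snd e \<in> snd ` fold (arrival_step E es S) us M" for M
    using assms(2)
  proof (induction us arbitrary: M)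
    case (Cons u us)
    show ?case
    proof (cases "fst e = u")
      case True
      then have "snd e \<in> snd ` arrival_step E es S u M"
        using assms(1) by (cases "snd e \<in> snd ` M") (auto simp: arrival_step_eq)
      then show ?thesis
        using mono[of "arrival_step E es S u M" us] by auto
    qed (use Cons in auto)
  qed simp
  then show ?thesis
    by (simp add: greedy_based_def)
qed

lemma greedy_based_weight_ge:
  assumes "set us = L - S"
  shows "sum w {e. last_tail e S} \<le> sum w (greedy_based E es S us)"
\<comment> \<open>Output edges are sent to the last tail at their offline vertex. The rule only asks
  that each last tail be hit by an edge at least as heavy, so existence for \<open>THE\<close> is
  checked only there.\<close>
proof (rule sum_le_included[where i = "\<lambda>f. THE e. last_tail e S \<and> snd e = snd f"])
  let ?B = "greedy_based E es S us"
  have B: "tail f S" if "f \<in> ?B" for f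
    using greedy_based_cand[OF that] assms by (auto simp: tail_def)
  then have BE: "?B \<subseteq> E"
    using cand_in_E unfolding tail_def by blast
  show "finite {e. last_tail e S}"
    using finite_cand[of S "\<lambda>e. last_tail e S"] by (rule rev_finite_subset) (auto simp: last_tail_def tail_def)
  show "finite ?B"
    using BE finite_E finite_subset by blast
  show "\<forall>f\<in>?B. 0 \<le> w f"
    using BE w_nonneg by auto
  show "\<forall>e\<in>{e. last_tail e S}. \<exists>f\<in>?B. (THE e. last_tail e S \<and> snd e = snd f) = e \<and> w e \<le> w f"
  proof
    fix e assume "e \<in> {e. last_tail e S}"
    then have e: "last_tail e S" "cand e S" "fst e \<notin> S"
      by (auto simp: last_tail_def tail_def)
    then have "fst e \<in> set us"
      using assms fst_in_L cand_in_E by blast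
    then obtain f where f: "f \<in> ?B" "snd f = snd e"
      using greedy_based_covers[OF e(2)] by (metis imageE)
    have "tail f S"
      using B f(1) by blast
    then have "w e \<le> w f"
      using f BE cand_in_E[OF e(2)] last_tail_max[OF e(1)] by (intro w_antimono) auto
    moreover have "e' = e" if e': "last_tail e' S" "snd e' = snd f" for e'
    proof -
      have t: "tail e' S" "tail e S"
        using e' e(1) by (simp_all add: last_tail_def)
      have "rank es e' = rank es e"
        using last_tail_max[OF e(1) t(1)] last_tail_max[OF e'(1) t(2)] e'(2) f(2) by simp
      then show ?thesis
        using t by (intro rank_eqD) (auto simp: tail_def intro: cand_in_E)
    qed
    then have "(THE e. last_tail e S \<and> snd e = snd f) = e"
      using e(1) f(2) by (intro the_equality) simp_all
    ultimately show "\<exists>f\<in>?B. (THE e. last_tail e S \<and> snd e = snd f) = e \<and> w e \<le> w f"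
      using f(1) by blast
  qed
qed

text \<open>If \<open>e\<close> is a tail but not the last one at its offline vertex, moving the online vertex of
  the next tail into the sample closes that offline vertex, and this makes \<open>e\<close> the last tail.\<close>

lemma next_tail:
  assumes "tail e S" "\<not> last_tail e S"
  obtains f where "tail f S" "snd f = snd e" "f \<in> G (insert (fst f) S)"
    "last_tail e (insert (fst f) S)"
proof -
  let ?Q = "\<lambda>f. tail f S \<and> snd f = snd e \<and> e \<lhd> f"
  define f where "f = arg_min (rank es) ?Q"
  obtain f0 where "?Q f0"
    using assms by (auto simp: last_tail_def not_le)
  then have f: "?Q f"
    unfolding f_def by (rule arg_min_natI)
  have min: "rank es f \<le> rank es g" if "?Q g" for g
    unfolding f_def by (rule arg_min_nat_le) (rule that)
  let ?T = "insert (fst f) S"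
  have fT: "f \<in> G ?T" and fS: "fst f \<notin> S"
    using f by (auto simp: tail_def cand_def)
  have agree: "g \<in> G ?T \<longleftrightarrow> g \<in> G S" if "g \<lhd> f" for g
    using fS _ that
  proof (rule G_insert_before)
    fix g assume "g \<lhd> f" "fst g = fst f" "g \<in> G ?T"
    then show False
      using fT G_eqI[of f ?T g] by auto
  qed
  \<comment> \<open>Freeness inspects strictly earlier edges only, so agreement before
    \<open>f\<close> extends to the rank of \<open>f\<close> itself.\<close>
  have free: "free g ?T \<longleftrightarrow> free g S" if "rank es g \<le> rank es f" for g
    using that agree unfolding free_def by (meson less_le_trans)
  have cand: "cand g ?T \<longleftrightarrow> cand g S" if "rank es g \<le> rank es f" for g
    using that free unfolding cand_iff_first_free by (meson less_imp_le less_le_trans)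
  \<comment> \<open>Otherwise one online vertex would have two candidates; so \<open>fst e\<close>
    stays outside the enlarged sample.\<close>
  have "fst e \<noteq> fst f"
    using assms(1) f cand_unique[of e S f] by (auto simp: tail_def)
  then have "tail e ?T"
    using assms(1) cand f by (auto simp: tail_def)
  moreover have "rank es g \<le> rank es e" if g: "tail g ?T" "snd g = snd e" for g
  proof (rule ccontr)
    assume eg: "\<not> rank es g \<le> rank es e"
    have "g \<noteq> f"
      using g by (auto simp: tail_def)
    then have "rank es g \<noteq> rank es f"
      using g(1) f rank_eqD[of g f] cand_in_E unfolding tail_def by blast
    moreover have "\<not> g \<lhd> f"
    proof
      assume "g \<lhd> f"
      then have "?Q g"
        using g cand eg by (auto simp: tail_def)
      then show False
        using min \<open>g \<lhd> f\<close> by fastforce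
    qed
    \<comment> \<open>Now \<open>f\<close> belongs to \<open>G ?T\<close> and occupies the offline
      vertex, so no later edge there is free.\<close>
    moreover have "\<not> f \<lhd> g"
      using g fT f cand_free[of g ?T] by (auto simp: tail_def free_def)
    ultimately show False
      by simp
  qed
  ultimately show ?thesis
    using that f fT unfolding last_tail_def by blast
qed

section \<open>Expected weights and the competitive ratio\<close>

text \<open>Moving the online vertex of the next tail into the sample injects \<open>?A\<close> into
  \<open>?Z\<close> and scales weights by \<open>p / (1 - p)\<close>. Adding \<open>p\<close> times
  the weight of \<open>?Z\<close> gives the claim.\<close>

lemma last_tail_weight_ge:
  assumes "0 < p" "p < 1"
  shows "p * sum (binomial_weight L p) {S \<in> Pow L. tail e S}
    \<le> sum (binomial_weight L p) {S \<in> Pow L. last_tail e S}"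
proof -
  let ?b = "binomial_weight L p"
  let ?A = "{S \<in> Pow L. tail e S \<and> \<not> last_tail e S}" and ?Z = "{S \<in> Pow L. last_tail e S}"
  define n where "n S = (SOME f. tail f S \<and> snd f = snd e \<and> f \<in> G (insert (fst f) S) \<and>
    last_tail e (insert (fst f) S))" for S
  let ?h = "\<lambda>S. insert (fst (n S)) S"
  have n: "tail (n S) S \<and> snd (n S) = snd e \<and> n S \<in> G (?h S) \<and> last_tail e (?h S)"
    if "S \<in> ?A" for S
    unfolding n_def by (rule someI_ex) (use next_tail that in blast)
  have L: "fst (n S) \<in> L" "fst (n S) \<notin> S" if "S \<in> ?A" for S
    using n[OF that] fst_in_L[OF cand_in_E, of "n S" S] by (auto simp: tail_def)
  have inj: "inj_on ?h ?A"
  proof (rule inj_onI)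
    fix S T assume S: "S \<in> ?A" and T: "T \<in> ?A" and eq: "?h S = ?h T"
    \<comment> \<open>The enlarged sample determines the moved vertex: \<open>n S\<close> is the
      only edge of \<open>G (?h S)\<close> at the offline vertex of \<open>e\<close>.\<close>
    have "n S = n T"
      using n[OF S] n[OF T] eq by (intro G_eqI[of _ "?h S"]) auto
    then show "S = T"
      using eq L[OF S] L[OF T] by (metis insert_ident)
  qed
  have fin: "finite ?A" "finite ?Z"
    using finite_L by auto
  have "p * sum ?b ?A = (\<Sum>S\<in>?A. (1 - p) * ?b (?h S))"
    unfolding sum_distrib_left using L finite_L
    by (intro sum.cong refl binomial_weight_insert[symmetric]) auto
  also have "\<dots> = (1 - p) * sum ?b (?h ` ?A)"
    using inj by (simp add: sum.reindex sum_distrib_left)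
  also have "\<dots> \<le> (1 - p) * sum ?b ?Z"
  proof (intro mult_left_mono sum_mono2)
    show "?h ` ?A \<subseteq> ?Z"
      using n L by blast
  qed (use fin assms in \<open>auto intro: binomial_weight_nonneg\<close>)
  finally have *: "p * sum ?b ?A \<le> (1 - p) * sum ?b ?Z" .
  have "{S \<in> Pow L. tail e S} = ?A \<union> ?Z"
    by (auto simp: last_tail_def)
  moreover have "sum ?b (?A \<union> ?Z) = sum ?b ?A + sum ?b ?Z"
    using fin by (intro sum.union_disjoint) auto
  ultimately show ?thesis
    using * by (simp add: algebra_simps)
qed

text \<open>Linearity of expectation; the assumption confines the inner sums to the finite set
  \<open>E\<close>.\<close>

lemma expected_weight:
  assumes "\<And>e S. S \<subseteq> L \<Longrightarrow> Q e S \<Longrightarrow> e \<in> E"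
  shows "(\<Sum>S\<in>Pow L. sum w {e. Q e S} * binomial_weight L p S)
    = (\<Sum>e\<in>E. w e * sum (binomial_weight L p) {S \<in> Pow L. Q e S})"
proof -
  have "(\<Sum>S\<in>Pow L. sum w {e. Q e S} * binomial_weight L p S)
      = (\<Sum>S\<in>Pow L. \<Sum>e\<in>{e\<in>E. Q e S}. w e * binomial_weight L p S)"
  proof (rule sum.cong[OF refl])
    fix S assume "S \<in> Pow L"
    then have "{e. Q e S} = {e\<in>E. Q e S}"
      using assms by auto
    then show "sum w {e. Q e S} * binomial_weight L p S
        = (\<Sum>e\<in>{e\<in>E. Q e S}. w e * binomial_weight L p S)"
      by (simp add: sum_distrib_right)
  qed
  also have "\<dots> = (\<Sum>e\<in>E. \<Sum>S\<in>{S\<in>Pow L. Q e S}. w e * binomial_weight L p S)"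
    using finite_L finite_E by (intro sum.swap_restrict) auto
  finally show ?thesis
    by (simp add: sum_distrib_left)
qed

text \<open>The bound on the output holds for each sample separately, so \<open>arrival\<close> may
  depend on the sample in any way.\<close>

theorem expected_greedy_based_ge:
  assumes p: "0 < p" "p < 1" and "\<And>S. S \<subseteq> L \<Longrightarrow> set (arrival S) = L - S"
  shows "p * (1 - p) * OPT E w \<le> (1 + p) *
    measure_pmf.expectation (sample_pmf L p) (\<lambda>S. sum w (greedy_based E es S (arrival S)))"
proof -
  let ?b = "binomial_weight L p"
  define c where "c e = sum ?b {S \<in> Pow L. cand e S}" for e
  have b0: "0 \<le> ?b S" for S
    using p by (simp add: binomial_weight_nonneg)
  have "OPT E w \<in> {sum w M | M. M \<subseteq> E \<and> matching M}"
    unfolding OPT_def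
  proof (rule Max_in)
    have "{sum w M | M. M \<subseteq> E \<and> matching M} \<subseteq> sum w ` Pow E"
      by auto
    then show "finite {sum w M | M. M \<subseteq> E \<and> matching M}"
      using finite_E by (meson finite_Pow_iff finite_imageI finite_subset)
    have "matching ({} :: ('a \<times> 'b) set)"
      by (simp add: matching_def)
    then show "{sum w M | M. M \<subseteq> E \<and> matching M} \<noteq> {}"
      by blast
  qed
  then obtain M where M: "M \<subseteq> E" "matching M" and opt: "OPT E w = sum w M"
    by auto
  have "OPT E w = (\<Sum>S\<in>Pow L. sum w M * ?b S)"
    unfolding opt sum_distrib_left[symmetric] using sum_binomial_weight[OF finite_L] p by simp
  also have "\<dots> \<le> (\<Sum>S\<in>Pow L. (sum w {e. cand e S} + sum w {e. e \<in> G S}) * ?b S)"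
    using matching_weight_le[OF M] b0 by (intro sum_mono mult_right_mono) auto
  also have "\<dots> = (\<Sum>e\<in>E. w e * c e) + (\<Sum>e\<in>E. w e * sum ?b {S \<in> Pow L. e \<in> G S})"
    unfolding distrib_right sum.distrib c_def
    using G_subset cand_in_E by (intro arg_cong2[where f = "(+)"] expected_weight) auto
  \<comment> \<open>A greedy edge is a candidate whose online vertex is sampled, and these two
    events are independent.\<close>
  also have "(\<Sum>e\<in>E. w e * sum ?b {S \<in> Pow L. e \<in> G S}) = p * (\<Sum>e\<in>E. w e * c e)"
    unfolding sum_distrib_left[of p]
  proof (rule sum.cong[OF refl])
    fix e assume "e \<in> E"
    have "{S \<in> Pow L. e \<in> G S} = {S \<in> Pow L. fst e \<in> S \<and> cand e S}"
      using in_G_iff cand_in by blast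
    then show "w e * sum ?b {S \<in> Pow L. e \<in> G S} = p * (w e * c e)"
      using sum_binomial_weight_in[OF finite_L fst_in_L[OF \<open>e \<in> E\<close>], of "cand e" p] cand_insert
      by (simp add: c_def)
  qed
  finally have opt_le: "OPT E w \<le> (1 + p) * (\<Sum>e\<in>E. w e * c e)"
    by (simp add: algebra_simps)
  have "p * (1 - p) * (\<Sum>e\<in>E. w e * c e) = (\<Sum>e\<in>E. w e * (p * sum ?b {S \<in> Pow L. tail e S}))"
    unfolding sum_distrib_left[of "p * (1 - p)"]
  proof (rule sum.cong[OF refl])
    fix e assume "e \<in> E"
    then show "p * (1 - p) * (w e * c e) = w e * (p * sum ?b {S \<in> Pow L. tail e S})"
      using sum_binomial_weight_notin[OF finite_L fst_in_L, of e "cand e" p] cand_insert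
      by (simp add: tail_def c_def)
  qed
  also have "\<dots> \<le> (\<Sum>e\<in>E. w e * sum ?b {S \<in> Pow L. last_tail e S})"
    using last_tail_weight_ge[OF p] w_nonneg by (intro sum_mono mult_left_mono) auto
  also have "\<dots> = (\<Sum>S\<in>Pow L. sum w {e. last_tail e S} * ?b S)"
    by (rule expected_weight[symmetric]) (auto simp: last_tail_def tail_def intro: cand_in_E)
  also have "\<dots> \<le> (\<Sum>S\<in>Pow L. sum w (greedy_based E es S (arrival S)) * ?b S)"
    using greedy_based_weight_ge assms(3) b0 by (intro sum_mono mult_right_mono) auto
  also have "\<dots> = measure_pmf.expectation (sample_pmf L p)
      (\<lambda>S. sum w (greedy_based E es S (arrival S)))"
    using expectation_sample_pmf[OF finite_L] p by simp
  finally have alg_ge: "p * (1 - p) * (\<Sum>e\<in>E. w e * c e) \<le> \<dots>" .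
  have "p * (1 - p) * OPT E w \<le> p * (1 - p) * ((1 + p) * (\<Sum>e\<in>E. w e * c e))"
    using opt_le p by (intro mult_left_mono) auto
  also have "\<dots> = (1 + p) * (p * (1 - p) * (\<Sum>e\<in>E. w e * c e))"
    by (simp add: mult_ac)
  also have "\<dots> \<le> (1 + p) * measure_pmf.expectation (sample_pmf L p)
      (\<lambda>S. sum w (greedy_based E es S (arrival S)))"
    using alg_ge p by (intro mult_left_mono) auto
  finally show ?thesis .
qed

end

theorem corollary2p7:
  fixes L :: "'a set" and R :: "'b set"
    and E :: "('a \<times> 'b) set" and w :: "'a \<times> 'b \<Rightarrow> real"
    and es :: "('a \<times> 'b) list"
    and arrival :: "'a set \<Rightarrow> 'a list"
  assumes "finite L" and "finite R" and "E \<subseteq> L \<times> R"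
    and "\<And>e. e \<in> E \<Longrightarrow> w e \<ge> 0"
    and "weight_ordering E w es"
    and "\<And>L'. L' \<subseteq> L \<Longrightarrow> arrival L' \<in> permutations_of_set (L - L')"
  shows "measure_pmf.expectation (sample_pmf L (sqrt 2 - 1))
           (\<lambda>L'. sum w (greedy_based E es L' (arrival L')))
         \<ge> (3 - 2 * sqrt 2) * OPT E w"
proof -
  interpret greedy_matching L E w es
    by unfold_locales (use assms in auto)
  let ?p = "sqrt 2 - 1"
  have p: "0 < ?p" "?p < 1"
    using real_sqrt_less_mono[of 2 4] by auto
  have "set (arrival S) = L - S" if "S \<subseteq> L" for S
    using assms(6)[OF that] by (simp add: permutations_of_set_def)
  from expected_greedy_based_ge[of ?p arrival, OF p this]
  have "?p * (1 - ?p) * OPT E w \<le> sqrt 2 * measure_pmf.expectation (sample_pmf L ?p)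
      (\<lambda>L'. sum w (greedy_based E es L' (arrival L')))" (is "_ \<le> sqrt 2 * ?X")
    by simp
  \<comment> \<open>Both sides equal \<open>3 * sqrt 2 - 4\<close>. Since
    \<open>1 + ?p = sqrt 2\<close>, the common factor cancels below.\<close>
  moreover have "?p * (1 - ?p) = sqrt 2 * (3 - 2 * sqrt 2)"
    by (simp add: algebra_simps)
  ultimately have "sqrt 2 * ((3 - 2 * sqrt 2) * OPT E w) \<le> sqrt 2 * ?X"
    by (simp only: mult.assoc)
  then show ?thesis
    by (rule mult_left_le_imp_le) simp
qed

end
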